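(* Let $\mathcal{X}=\overline{([-x_1,x_2],0)}$ with $x_1,x_2>0$ and $x_1<x_2$. If $\mathcal{Y}=\overline{([-y_1,y_2],0)}$ with $y_1,y_2>0$ satisfies $\dfrac{x_1}{x_2}>\dfrac{y_2}{y_1}$ and $\dfrac{x_1}{x_2}<\dfrac{y_1}{y_2}$, then there is a unique pair $(\mathcal{Z},\mathcal{R})$ of non-invertible elements $\mathcal{Z}=\overline{([-z_3,z_2],0)}$, $\mathcal{R}=\overline{([-r_1,r_2],0)}$ with $z_2,z_3,r_1,r_2\ge0$ such that $\mathcal{Y}=\mathcal{X}\bullet\mathcal{Z}+\mathcal{R}$, $\mathcal{R}<\mathcal{Y}$, and $l(\mathcal{R})$ is minimal (among all such pairs satisfying $\mathcal{Y}=\mathcal{X}\bullet\mathcal{Z}+\mathcal{R}$ and $\mathcal{R}<\mathcal{Y}$). This pair is given by $$\mathcal{Z}=\overline{\left(\left[-\frac{y_2}{x_1},0\right],0\right)},\qquad \mathcal{R}=\overline{\left(\left[-\frac{x_1y_1-x_2y_2}{x_1},0\right],0\right)}.$$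
   Context: $\mathbb{IR}$ is the set of closed bounded intervals $[a,b]$ of $\mathbb{R}$, $a\le b$, with $0=[0,0]$ and addition $[a,b]+[c,d]=[a+c,b+d]$. $\overline{\mathbb{IR}}$ is the quotient of $\mathbb{IR}\times\mathbb{IR}$ by $(x,y)\sim(z,t)\iff x+t=y+z$, with classes $\overline{(x,y)}$, addition $\overline{(x,y)}+\overline{(z,t)}=\overline{(x+z,y+t)}$, and $\mathcal{X}\smallsetminus\mathcal{X}'$ the corresponding group difference. For $\mathcal{X}=\overline{([a,b],0)}$, $l(\mathcal{X})=b-a$. An element is positive ($>0$) if it is of the form $\overline{(A,0)}$ with $A$ a non-degenerate interval; $\mathcal{R}<\mathcal{Y}$ means $\mathcal{Y}\smallsetminus\mathcal{R}>0$. $\mathcal{A}_4$ is the 4-dimensional real algebra with product $x\cdot y=(x_1y_1+x_4y_4,\;x_2y_2+x_3y_3,\;x_3y_2+x_2y_3,\;x_4y_1+x_1y_4)$ and unit $(1,1,0,0)$. The injective map $\varphi:\mathbb{IR}\to\mathcal{A}_4$ sends $[a,b]$ to $(a,b,0,0)$ if $a,b\ge0$, to $(0,b,-a,0)$ if $a\le0\le b$, and to $(0,0,-a,-b)$ if $a,b\le0$. For $K,L\in\mathbb{IR}$ the element $\varphi(K)\cdot\varphi(L)$ lies in the image of $\varphi$ and $\overline{(K,0)}\bullet\overline{(L,0)}=\overline{(\varphi^{-1}(\varphi(K)\cdot\varphi(L)),0)}$. In particular, for nonnegative $x_1,x_2,z_2,z_3$: $\overline{([-x_1,x_2],0)}\bullet\overline{([-z_3,z_2],0)}=\overline{([-(x_1z_2+x_2z_3),\,x_2z_2+x_1z_3],0)}$.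 An element $\overline{(K,0)}$ is called non-invertible if $\varphi(K)$ is not invertible in $\mathcal{A}_4$, i.e. if $0\in K$. *)

theory Defs
  imports Complex_Main "HOL-Library.Interval"
begin

(* Unspecified unless a \<le> b. *)
definition ivl :: "real \<Rightarrow> real \<Rightarrow> real interval" where
  "ivl a b = Interval (a, b)"

lemma lower_ivl [simp]: "a \<le> b \<Longrightarrow> lower (ivl a b) = a"
  and upper_ivl [simp]: "a \<le> b \<Longrightarrow> upper (ivl a b) = b"
  by (simp_all add: ivl_def lower.rep_eq upper.rep_eq Interval_inverse)


section \<open>The group of generalized intervals\<close>

definition ivl_pair_rel :: "real interval \<times> real interval \<Rightarrow> real interval \<times> real interval \<Rightarrow> bool" where
  "ivl_pair_rel = (\<lambda>(x, y) (z, t). x + t = y + z)"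

lemma ivl_pair_rel_equivp: "equivp ivl_pair_rel"
  by (rule equivpI) (auto simp: ivl_pair_rel_def reflp_def symp_def transp_def interval_eq_iff)

quotient_type gint = "real interval \<times> real interval" / ivl_pair_rel
  by (rule ivl_pair_rel_equivp)

lift_definition gint_class :: "real interval \<Rightarrow> real interval \<Rightarrow> gint" is Pair .

definition gint_of :: "real interval \<Rightarrow> gint" where
  "gint_of K = gint_class K 0"

instantiation gint :: ab_group_add
begin

lift_definition zero_gint :: gint is "(0, 0)" .

lift_definition plus_gint :: "gint \<Rightarrow> gint \<Rightarrow> gint"
  is "\<lambda>(x, y) (z, t). (x + z, y + t)"
  by (auto simp: ivl_pair_rel_def interval_eq_iff)

lift_definition uminus_gint :: "gint \<Rightarrow> gint"
  is "\<lambda>(x, y). (y, x)"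
  by (auto simp: ivl_pair_rel_def interval_eq_iff)

definition minus_gint :: "gint \<Rightarrow> gint \<Rightarrow> gint" where
  "minus_gint X Y = X + - Y"

instance
  by standard
    (simp add: minus_gint_def | transfer, auto simp: ivl_pair_rel_def interval_eq_iff)+

end

lemma gint_class_eq_iff: "gint_class A B = gint_class C D \<longleftrightarrow> A + D = B + C"
  by transfer (simp add: ivl_pair_rel_def)

lemma gint_of_eq_iff [simp]: "gint_of K = gint_of L \<longleftrightarrow> K = L"
  by (auto simp: gint_of_def gint_class_eq_iff)

lemma inj_gint_of: "inj gint_of"
  by (simp add: inj_def)

lemma gint_of_add: "gint_of (K + L) = gint_of K + gint_of L"
  unfolding gint_of_def by transfer (simp add: ivl_pair_rel_def)

lemma gint_of_0: "gint_of 0 = 0"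
  unfolding gint_of_def by transfer (simp add: ivl_pair_rel_def)

definition gint_pos :: "gint \<Rightarrow> bool" where
  "gint_pos X \<longleftrightarrow> (\<exists>A. lower A < upper A \<and> X = gint_of A)"

instantiation gint :: ordered_ab_group_add
begin

definition less_gint :: "gint \<Rightarrow> gint \<Rightarrow> bool" where
  "X < Y \<longleftrightarrow> gint_pos (Y - X)"

definition less_eq_gint :: "gint \<Rightarrow> gint \<Rightarrow> bool" where
  "X \<le> Y \<longleftrightarrow> X = Y \<or> X < (Y :: gint)"

instance
proof
  have add: "gint_pos (X + Y)" if "gint_pos X" "gint_pos Y" for X Y
    using that unfolding gint_pos_def
    by (metis add_strict_mono gint_of_add lower_plus upper_plus)
  have "\<not> gint_pos 0"
    by (auto simp: gint_pos_def simp flip: gint_of_0)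
  with add have neg: "\<not> gint_pos (- X)" if "gint_pos X" for X
    using that by (metis add.right_inverse)
  fix X Y Z :: gint
  show "X < Y \<longleftrightarrow> X \<le> Y \<and> \<not> Y \<le> X"
    using \<open>\<not> gint_pos 0\<close> neg[of "Y - X"] by (auto simp: less_gint_def less_eq_gint_def)
  show "X \<le> X" by (simp add: less_eq_gint_def)
  show "X \<le> Z" if "X \<le> Y" "Y \<le> Z"
    using that add[of "Y - X" "Z - Y"] by (auto simp: less_gint_def less_eq_gint_def)
  show "X = Y" if "X \<le> Y" "Y \<le> X"
    using that neg[of "Y - X"] by (auto simp: less_gint_def less_eq_gint_def)
  show "Z + X \<le> Z + Y" if "X \<le> Y"
    using that by (auto simp: less_gint_def less_eq_gint_def)
qed

end

(* Meaningful only for X in the range of gint_of. *)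
definition gint_length :: "gint \<Rightarrow> real" where
  "gint_length X = width (inv gint_of X)"

lemma gint_length_gint_of [simp]: "gint_length (gint_of K) = width K"
  by (simp add: gint_length_def inv_f_f inj_gint_of)


section \<open>The four-dimensional algebra\<close>

datatype a4 = A4 (c1: real) (c2: real) (c3: real) (c4: real)

instantiation a4 :: "{comm_ring_1, real_algebra_1}"
begin

definition "0 = A4 0 0 0 0"
definition "1 = A4 1 1 0 0"
definition "x + y = A4 (c1 x + c1 y) (c2 x + c2 y) (c3 x + c3 y) (c4 x + c4 y)"
definition "- x = A4 (- c1 x) (- c2 x) (- c3 x) (- c4 x)"
definition "x - y = A4 (c1 x - c1 y) (c2 x - c2 y) (c3 x - c3 y) (c4 x - c4 y)"
definition "r *\<^sub>R x = A4 (r * c1 x) (r * c2 x) (r * c3 x) (r * c4 x)"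
definition "x * y = A4
   (c1 x * c1 y + c4 x * c4 y) (c2 x * c2 y + c3 x * c3 y)
   (c3 x * c2 y + c2 x * c3 y) (c4 x * c1 y + c1 x * c4 y)"

instance
  by standard
    (simp_all add: zero_a4_def one_a4_def plus_a4_def uminus_a4_def minus_a4_def
      scaleR_a4_def times_a4_def algebra_simps)

end

(* The three cases overlap exactly on intervals having 0 as an endpoint, and agree there. *)
definition phi :: "real interval \<Rightarrow> a4" where
  "phi K = (let a = lower K; b = upper K in
     if 0 \<le> a then A4 a b 0 0
     else if 0 \<le> b then A4 0 b (- a) 0
     else A4 0 0 (- a) (- b))"

lemma phi_cases:
  "0 \<le> lower K \<Longrightarrow> phi K = A4 (lower K) (upper K) 0 0"
  "lower K \<le> 0 \<Longrightarrow> 0 \<le> upper K \<Longrightarrow> phi K = A4 0 (upper K) (- lower K) 0"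
  "upper K \<le> 0 \<Longrightarrow> phi K = A4 0 0 (- lower K) (- upper K)"
  using lower_le_upper[of K] by (auto simp: phi_def Let_def simp del: lower_le_upper)

lemma inj_phi: "inj phi"
proof (rule injI)
  fix K L assume "phi K = phi L"
  then show "K = L"
    using lower_le_upper[of K] lower_le_upper[of L]
    by (auto simp: phi_def Let_def interval_eq_iff split: if_splits)
qed

lemma phi_range:
  "x \<in> range phi \<longleftrightarrow>
     (\<exists>a b. 0 \<le> a \<and> a \<le> b \<and> x = A4 a b 0 0) \<or>
     (\<exists>a b. 0 \<le> a \<and> 0 \<le> b \<and> x = A4 0 b a 0) \<or>
     (\<exists>a b. 0 \<le> b \<and> b \<le> a \<and> x = A4 0 0 a b)" (is "_ \<longleftrightarrow> ?R")
proof
  assume "x \<in> range phi"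
  then obtain K where "x = phi K" by blast
  then show ?R
    using lower_le_upper[of K] by (auto simp: phi_def Let_def)
next
  assume ?R
  then consider a b where "0 \<le> a" "a \<le> b" "x = A4 a b 0 0"
    | a b where "0 \<le> a" "0 \<le> b" "x = A4 0 b a 0"
    | a b where "0 \<le> b" "b \<le> a" "x = A4 0 0 a b"
    by blast
  then show "x \<in> range phi"
  proof cases
    case (1 a b)
    then have "x = phi (ivl a b)" by (simp add: phi_cases)
    then show ?thesis by blast
  next
    case (2 a b)
    then have "x = phi (ivl (- a) b)" by (simp add: phi_cases)
    then show ?thesis by blast
  next
    case (3 a b)
    then have "x = phi (ivl (- a) (- b))" by (simp add: phi_cases)
    then show ?thesis by blast
  qed
qed

lemma phi_mult_in_range: "phi K * phi L \<in> range phi"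
proof -
  have "phi K \<in> range phi" "phi L \<in> range phi" by auto
  then show ?thesis
    unfolding phi_range
    by (elim disjE exE conjE) (auto simp: times_a4_def intro!: mult_mono)
qed


section \<open>Multiplication and division with remainder\<close>

(* Meaningful only for X, Y in the range of gint_of. *)
definition gint_mult :: "gint \<Rightarrow> gint \<Rightarrow> gint"  (infixl \<open>\<bullet>\<close> 70) where
  "X \<bullet> Y = gint_of (inv phi (phi (inv gint_of X) * phi (inv gint_of Y)))"

lemma gint_mult_gint_of: "gint_of K \<bullet> gint_of L = gint_of (inv phi (phi K * phi L))"
  by (simp add: gint_mult_def inv_f_f inj_gint_of)

lemma gint_mult_around_0:
  assumes "0 \<le> x1" "0 \<le> x2" "0 \<le> z2" "0 \<le> z3"
  shows "gint_of (ivl (- x1) x2) \<bullet> gint_of (ivl (- z3) z2) =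
         gint_of (ivl (- (x1 * z2 + x2 * z3)) (x2 * z2 + x1 * z3))"
proof -
  have "- (x1 * z2 + x2 * z3) \<le> 0" "0 \<le> x2 * z2 + x1 * z3"
    using assms by (simp_all only: neg_le_0_iff_le add_nonneg_nonneg mult_nonneg_nonneg)
  moreover from this have "- (x1 * z2 + x2 * z3) \<le> x2 * z2 + x1 * z3"
    by linarith
  ultimately have "phi (ivl (- x1) x2) * phi (ivl (- z3) z2) =
      phi (ivl (- (x1 * z2 + x2 * z3)) (x2 * z2 + x1 * z3))"
    using assms by (simp add: phi_cases times_a4_def del: minus_add_distrib)
  then show ?thesis by (simp add: gint_mult_gint_of inv_f_f inj_phi)
qed

definition noninvertible :: "gint \<Rightarrow> bool" where
  "noninvertible X \<longleftrightarrow> (\<exists>K. X = gint_of K \<and> \<not> (\<exists>v. phi K * v = 1))"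

lemma noninvertible_iff: "noninvertible (gint_of K) \<longleftrightarrow> 0 \<in> set_of K"
proof
  assume "noninvertible (gint_of K)"
  then have no: "phi K * v \<noteq> 1" for v by (auto simp: noninvertible_def)
  show "0 \<in> set_of K"
  proof (rule ccontr)
    assume "0 \<notin> set_of K"
    then consider "0 < lower K" | "upper K < 0" by (auto simp: set_of_eq)
    then show False
    proof cases
      case 1
      then have "phi K * A4 (1 / lower K) (1 / upper K) 0 0 = 1"
        using lower_le_upper[of K] by (simp add: phi_cases times_a4_def one_a4_def del: lower_le_upper)
      with no show False by blast
    next
      case 2
      then have "phi K * A4 0 0 (- 1 / lower K) (- 1 / upper K) = 1"
        using lower_le_upper[of K] by (simp add: phi_cases times_a4_def one_a4_def del: lower_le_upper)
      with no show False by blast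
    qed
  qed
next
  assume "0 \<in> set_of K"
  then show "noninvertible (gint_of K)"
    by (auto simp: noninvertible_def set_of_eq phi_cases times_a4_def one_a4_def)
qed

definition is_division :: "gint \<Rightarrow> gint \<Rightarrow> gint \<Rightarrow> gint \<Rightarrow> bool" where
  "is_division X Y Z R \<longleftrightarrow>
     noninvertible Z \<and> noninvertible R \<and>
     (\<exists>z2 z3. 0 \<le> z2 \<and> 0 \<le> z3 \<and> Z = gint_of (ivl (- z3) z2)) \<and>
     (\<exists>r1 r2. 0 \<le> r1 \<and> 0 \<le> r2 \<and> R = gint_of (ivl (- r1) r2)) \<and>
     Y = X \<bullet> Z + R \<and> R < Y"

definition is_minimal_division :: "gint \<Rightarrow> gint \<Rightarrow> gint \<Rightarrow> gint \<Rightarrow> bool" where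
  "is_minimal_division X Y Z R \<longleftrightarrow>
     is_division X Y Z R \<and>
     (\<forall>Z' R'. is_division X Y Z' R' \<longrightarrow> gint_length R \<le> gint_length R')"

end

theory Submission
  imports Defs
begin

text \<open>
  Division of \<^term>\<open>ivl (- y1) y2\<close> by \<^term>\<open>ivl (- x1) x2\<close> is a linear program in two
  variables. By the product formula for intervals around zero, a quotient
  \<^term>\<open>ivl (- z3) z2\<close> with remainder \<^term>\<open>ivl (- r1) r2\<close> means
  \<open>y1 = x1 * z2 + x2 * z3 + r1\<close> and \<open>y2 = x2 * z2 + x1 * z3 + r2\<close>, all unknowns being
  nonnegative, and the remainder lies strictly below the dividend exactly if the product is
  non-degenerate, that is, if \<open>z2 + z3\<close> is positive (\<open>is_division_around_0_iff\<close>).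
  Adding the two equations shows that the remainder has length
  \<open>y1 + y2 - (x1 + x2) * (z2 + z3)\<close>, so minimising it means maximising \<open>z2 + z3\<close>.

  The second equation, with \<open>r2 \<ge> 0\<close>, gives
  \<open>x1 * (z2 + z3) \<le> y2 - (x2 - x1) * z2 \<le> y2\<close>. As \<open>x1 < x2\<close>, the bound
  \<open>z2 + z3 \<le> y2 / x1\<close> is attained only at \<open>z2 = 0\<close>, \<open>z3 = y2 / x1\<close>. At this vertex
  \<open>r2 = 0\<close> and \<open>r1 = (x1 * y1 - x2 * y2) / x1\<close>, and the hypothesis
  \<open>x1 / x2 > y2 / y1\<close> says precisely that this \<open>r1\<close> is positive, so the vertex is feasible.
\<close>

lemma ivl_around_0_eq_iff:
  assumes "0 \<le> a" "0 \<le> b" "0 \<le> c" "0 \<le> d"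
  shows "ivl (- a) b = ivl (- c) d \<longleftrightarrow> a = c \<and> b = d"
  using assms by (simp add: interval_eq_iff)

lemma ivl_around_0_add:
  assumes "0 \<le> a" "0 \<le> b" "0 \<le> c" "0 \<le> d"
  shows "ivl (- a) b + ivl (- c) d = ivl (- (a + c)) (b + d)"
proof -
  have "- (a + c) \<le> b + d" using assms by linarith
  with assms show ?thesis by (simp add: interval_eq_iff del: minus_add_distrib)
qed

lemma width_ivl: "a \<le> b \<Longrightarrow> width (ivl a b) = b - a"
  by (simp add: width_def)

lemma gint_pos_gint_of_iff: "gint_pos (gint_of K) \<longleftrightarrow> 0 < width K"
  by (auto simp: gint_pos_def width_def)

lemma noninvertible_ivl_around_0:
  "0 \<le> a \<Longrightarrow> 0 \<le> b \<Longrightarrow> noninvertible (gint_of (ivl (- a) b))"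
  by (simp add: noninvertible_iff set_of_eq)

text \<open>
  Once \<open>Y = X \<bullet> Z + R\<close> holds, \<open>R < Y\<close> only speaks of the product \<open>X \<bullet> Z = Y - R\<close>, whose
  length is \<open>(x1 + x2) * (z2 + z3)\<close>; this is where the condition \<open>0 < z2 + z3\<close> comes from.
\<close>

lemma is_division_around_0_iff:
  assumes "0 < x1" "0 < x2" "0 \<le> y1" "0 \<le> y2"
  shows "is_division (gint_of (ivl (- x1) x2)) (gint_of (ivl (- y1) y2)) Z R \<longleftrightarrow>
    (\<exists>z2 z3 r1 r2. 0 \<le> z2 \<and> 0 \<le> z3 \<and> 0 \<le> r1 \<and> 0 \<le> r2 \<and>
       Z = gint_of (ivl (- z3) z2) \<and> R = gint_of (ivl (- r1) r2) \<and>
       y1 = x1 * z2 + x2 * z3 + r1 \<and> y2 = x2 * z2 + x1 * z3 + r2 \<and> 0 < z2 + z3)"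
proof -
  let ?X = "gint_of (ivl (- x1) x2)" and ?Y = "gint_of (ivl (- y1) y2)"
  have equation_and_order:
    "?Y = ?X \<bullet> gint_of (ivl (- z3) z2) + gint_of (ivl (- r1) r2) \<and> gint_of (ivl (- r1) r2) < ?Y \<longleftrightarrow>
     y1 = x1 * z2 + x2 * z3 + r1 \<and> y2 = x2 * z2 + x1 * z3 + r2 \<and> 0 < z2 + z3"
    if "0 \<le> z2" "0 \<le> z3" "0 \<le> r1" "0 \<le> r2" for z2 z3 r1 r2
  proof -
    define p q where "p = x1 * z2 + x2 * z3" and "q = x2 * z2 + x1 * z3"
    have pq: "0 \<le> p" "0 \<le> q" using assms that by (simp_all add: p_def q_def)
    have product: "?X \<bullet> gint_of (ivl (- z3) z2) = gint_of (ivl (- p) q)"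
      using assms that by (simp add: gint_mult_around_0 p_def q_def del: minus_add_distrib)
    have equation: "?Y = gint_of (ivl (- p) q) + gint_of (ivl (- r1) r2) \<longleftrightarrow> y1 = p + r1 \<and> y2 = q + r2"
      using assms that pq
      by (simp add: ivl_around_0_add ivl_around_0_eq_iff del: minus_add_distrib flip: gint_of_add)
    have order: "gint_of (ivl (- r1) r2) < ?Y \<longleftrightarrow> 0 < z2 + z3"
      if "?Y = gint_of (ivl (- p) q) + gint_of (ivl (- r1) r2)"
    proof -
      have "gint_of (ivl (- r1) r2) < ?Y \<longleftrightarrow> 0 < p + q"
        using that pq by (simp add: less_gint_def gint_pos_gint_of_iff width_ivl add.commute)
      also have "p + q = (x1 + x2) * (z2 + z3)" by (simp add: p_def q_def algebra_simps)
      finally show ?thesis using assms by (simp add: zero_less_mult_iff)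
    qed
    show ?thesis using equation order unfolding product p_def[symmetric] q_def[symmetric] by blast
  qed
  show ?thesis (is "_ \<longleftrightarrow> ?R")
  proof
    assume division: "is_division ?X ?Y Z R"
    then obtain z2 z3 r1 r2 where nonneg: "0 \<le> z2" "0 \<le> z3" "0 \<le> r1" "0 \<le> r2"
      and ZR: "Z = gint_of (ivl (- z3) z2)" "R = gint_of (ivl (- r1) r2)"
      unfolding is_division_def by (elim conjE exE)
    with division have "?Y = ?X \<bullet> gint_of (ivl (- z3) z2) + gint_of (ivl (- r1) r2) \<and>
        gint_of (ivl (- r1) r2) < ?Y"
      unfolding is_division_def by (elim conjE) (intro conjI, simp_all only:)
    then show ?R
      unfolding equation_and_order[OF nonneg] using nonneg ZR by (intro exI conjI) (elim conjE, assumption)+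
  next
    assume ?R
    then obtain z2 z3 r1 r2 where nonneg: "0 \<le> z2" "0 \<le> z3" "0 \<le> r1" "0 \<le> r2"
      and ZR: "Z = gint_of (ivl (- z3) z2)" "R = gint_of (ivl (- r1) r2)"
      and eqs: "y1 = x1 * z2 + x2 * z3 + r1 \<and> y2 = x2 * z2 + x1 * z3 + r2 \<and> 0 < z2 + z3"
      by (elim exE conjE) (rule that, (assumption | intro conjI)+)
    note eqs[folded equation_and_order[OF nonneg]]
    moreover have "noninvertible Z" "noninvertible R"
      unfolding ZR using nonneg by (simp_all only: noninvertible_ivl_around_0)
    ultimately show "is_division ?X ?Y Z R"
      unfolding is_division_def using nonneg ZR by (intro conjI) (simp only:, fast)+
  qed
qed

text \<open>
  The maximum of \<open>z2 + z3\<close> in the linear program: one unit of \<open>z3\<close> uses up less of the bound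
  \<open>y2\<close> than one unit of \<open>z2\<close>, so all of it is spent on \<open>z3\<close>.
\<close>

lemma sum_le_if_weighted_sum_le:
  fixes x1 x2 y2 z2 z3 :: real
  assumes "0 < x1" "x1 < x2" "0 \<le> z2" "x2 * z2 + x1 * z3 \<le> y2"
  shows "z2 + z3 \<le> y2 / x1"
    and "z2 + z3 = y2 / x1 \<Longrightarrow> z2 = 0"
proof -
  have bound: "x1 * (z2 + z3) \<le> y2 - (x2 - x1) * z2"
    using assms(4) by (simp add: algebra_simps)
  moreover have nonneg: "0 \<le> (x2 - x1) * z2" using assms by simp
  ultimately have "x1 * (z2 + z3) \<le> y2" by linarith
  then show "z2 + z3 \<le> y2 / x1" using assms(1) by (simp add: field_simps)
  assume "z2 + z3 = y2 / x1"
  then have "x1 * (z2 + z3) = y2" using assms(1) by simp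
  with bound nonneg have "(x2 - x1) * z2 = 0" by linarith
  then show "z2 = 0" using assms(2) by simp
qed

theorem theorem25:
  fixes x1 x2 y1 y2 :: real and X Y :: gint
  assumes "X = gint_of (ivl (- x1) x2)" and "0 < x1" and "0 < x2" and "x1 < x2"
    and "Y = gint_of (ivl (- y1) y2)" and "0 < y1" and "0 < y2"
    and "x1 / x2 > y2 / y1" and "x1 / x2 < y1 / y2"
  shows "(\<exists>!ZR. is_minimal_division X Y (fst ZR) (snd ZR)) \<and>
    is_minimal_division X Y
      (gint_of (ivl (- (y2 / x1)) 0))
      (gint_of (ivl (- ((x1 * y1 - x2 * y2) / x1)) 0))"
proof -
  define z r where "z = y2 / x1" and "r = (x1 * y1 - x2 * y2) / x1"
  define Z0 R0 where "Z0 = gint_of (ivl (- z) 0)" and "R0 = gint_of (ivl (- r) 0)"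
  note division_iff =
    is_division_around_0_iff[OF assms(2,3) less_imp_le[OF assms(6)] less_imp_le[OF assms(7)],
      folded assms(1,5)]
  have "x2 * y2 < x1 * y1" using assms by (simp add: field_simps)
  then have "0 < r" using assms by (simp add: r_def)
  have "0 < z" using assms by (simp add: z_def)
  have y: "y1 = x2 * z + r" "y2 = x1 * z" using assms by (simp_all add: z_def r_def field_simps)
  have division0: "is_division X Y Z0 R0"
    unfolding division_iff
    by (rule exI[of _ 0], rule exI[of _ z], rule exI[of _ r], rule exI[of _ 0])
      (use \<open>0 < z\<close> \<open>0 < r\<close> y in \<open>simp add: Z0_def R0_def\<close>)
  have length0: "gint_length R0 = r" using \<open>0 < r\<close> by (simp add: R0_def width_ivl)
  have optimal: "r \<le> gint_length R \<and> (gint_length R \<le> r \<longrightarrow> Z = Z0 \<and> R = R0)"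
    if "is_division X Y Z R" for Z R
  proof -
    from that[unfolded division_iff] obtain z2 z3 r1 r2 where
      nonneg: "0 \<le> z2" "0 \<le> z3" "0 \<le> r1" "0 \<le> r2"
      and ZR: "Z = gint_of (ivl (- z3) z2)" "R = gint_of (ivl (- r1) r2)"
      and eqs: "y1 = x1 * z2 + x2 * z3 + r1" "y2 = x2 * z2 + x1 * z3 + r2"
      by blast
    have "gint_length R = r1 + r2" using nonneg by (simp add: ZR width_ivl)
    \<comment> \<open>The excess length is the distance of \<open>z2 + z3\<close> from its maximum \<open>z\<close>, up to a factor.\<close>
    also have "\<dots> = r + (x1 + x2) * (z - (z2 + z3))"
      using eqs y by (simp add: algebra_simps)
    finally have len: "gint_length R = r + (x1 + x2) * (z - (z2 + z3))" .
    have weighted: "x2 * z2 + x1 * z3 \<le> y2" using eqs(2) nonneg(4) by linarith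
    note max = sum_le_if_weighted_sum_le[OF assms(2,4) nonneg(1) weighted, folded z_def]
    have "r \<le> gint_length R" using len max(1) assms(2,3) by simp
    moreover have "Z = Z0 \<and> R = R0" if "gint_length R \<le> r"
    proof -
      have "(x1 + x2) * (z - (z2 + z3)) \<le> 0" using that len by linarith
      then have "z2 + z3 = z" using max(1) assms(2,3) by (simp add: mult_le_0_iff)
      with max(2) have "z2 = 0" "z3 = z" by simp_all
      with eqs y have "r1 = r" "r2 = 0" by simp_all
      with \<open>z2 = 0\<close> \<open>z3 = z\<close> show ?thesis by (simp add: ZR Z0_def R0_def)
    qed
    ultimately show ?thesis by blast
  qed
  have minimal0: "is_minimal_division X Y Z0 R0"
    unfolding is_minimal_division_def length0 using division0 optimal by blast
  have unique: "Z = Z0 \<and> R = R0" if "is_minimal_division X Y Z R" for Z R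
  proof -
    have "is_division X Y Z R" "gint_length R \<le> r"
      using that division0 unfolding is_minimal_division_def length0[symmetric] by blast+
    with optimal show ?thesis by blast
  qed
  have "\<exists>!ZR. is_minimal_division X Y (fst ZR) (snd ZR)"
    by (rule ex1I[of _ "(Z0, R0)"]) (simp_all add: minimal0 prod_eq_iff unique)
  with minimal0 show ?thesis by (simp add: Z0_def R0_def z_def r_def)
qed

end
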